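(* For any graph $G$, given $\phi^G\pmod 4$ we can compute $\phi^{\overline{G}}\pmod 4$. That is, if $G$ and $H$ are graphs with $\phi^G\equiv\phi^H\pmod 4$ (coefficientwise), then $\phi^{\overline{G}}\equiv\phi^{\overline{H}}\pmod 4$.
   Context: Graphs are finite, simple and undirected. For a graph $G$ with adjacency matrix $A$, the characteristic polynomial is $\phi^G(x)=\det(xI-A)\in\mathbb{Z}[x]$. $\overline{G}$ denotes the complement of $G$. *)

theory Defs
  imports
    "Graph_Theory.Graph_Theory"
    "Jordan_Normal_Form.Char_Poly"
    "HOL-Number_Theory.Cong"
begin

text \<open>
  A finite simple undirected graph is a pair digraph satisfying \<^locale>\<open>pair_graph\<close>:
  finitely many vertices, no loops, and a symmetric set of arcs, so that an edge
  between u and v is the pair of arcs (u,v), (v,u).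
\<close>

definition graph_complement :: "'a pair_pre_digraph \<Rightarrow> 'a pair_pre_digraph" where
  "graph_complement G =
     \<lparr> pverts = pverts G,
       parcs = {(u, v). u \<in> pverts G \<and> v \<in> pverts G \<and> u \<noteq> v \<and> (u, v) \<notin> parcs G} \<rparr>"

text \<open>Rows and columns are indexed by the positions in an enumeration of the vertices.\<close>

definition adjacency_mat :: "'a pair_pre_digraph \<Rightarrow> 'a list \<Rightarrow> int mat" where
  "adjacency_mat G vs =
     mat (length vs) (length vs) (\<lambda>(i, j). if (vs ! i, vs ! j) \<in> parcs G then 1 else 0)"

definition vertex_enum :: "'a pair_pre_digraph \<Rightarrow> 'a list" where
  "vertex_enum G = (SOME vs. distinct vs \<and> set vs = pverts G)"

text \<open>
  The choice of the enumeration is immaterial, see \<open>graph_char_poly_eq\<close> below.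
\<close>

definition graph_char_poly :: "'a pair_pre_digraph \<Rightarrow> int poly" where
  "graph_char_poly G = char_poly (adjacency_mat G (vertex_enum G))"

lemma pair_graph_complement:
  assumes "pair_graph G"
  shows "pair_graph (graph_complement G)"
proof -
  interpret pair_graph G by fact
  have "finite (parcs (graph_complement G))"
    by (rule finite_subset[of _ "pverts G \<times> pverts G"])
       (auto simp: graph_complement_def pair_finite_verts)
  moreover have "finite (pverts (graph_complement G))"
    by (simp add: graph_complement_def pair_finite_verts)
  moreover have "symmetric (with_proj (graph_complement G))"
    by (auto simp: symmetric_def graph_complement_def sym_def dest: arcs_symmetric)
  ultimately show ?thesis
    by unfold_locales (auto simp: graph_complement_def)
qed

lemma vertex_enum:
  assumes "finite (pverts G)"
  shows "distinct (vertex_enum G)" "set (vertex_enum G) = pverts G"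
proof -
  have "\<exists>vs. distinct vs \<and> set vs = pverts G"
    using finite_distinct_list[OF assms] by blast
  from someI_ex[OF this] show "distinct (vertex_enum G)" "set (vertex_enum G) = pverts G"
    by (simp_all add: vertex_enum_def)
qed

lemma sum_enum:
  fixes f :: "'a \<Rightarrow> 'b :: comm_monoid_add"
  assumes "distinct vs"
  shows "(\<Sum>k = 0..<length vs. f (vs ! k)) = sum f (set vs)"
  using assms
  by (simp add: sum.distinct_set_conv_list sum_list_sum_nth)

lemma char_poly_adjacency_mat_cong:
  assumes "distinct vs" "distinct ws" "set vs = set ws"
  shows "char_poly (adjacency_mat G vs) = char_poly (adjacency_mat G ws)"
proof (rule char_poly_similar)
  define n where "n = length vs"
  have n': "length ws = n"
    using assms by (metis distinct_card n_def)
  define P :: "int mat" where "P = mat n n (\<lambda>(i, j). if vs ! i = ws ! j then 1 else 0)"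
  define Q :: "int mat" where "Q = mat n n (\<lambda>(i, j). if ws ! i = vs ! j then 1 else 0)"
  have vs: "vs ! i \<in> set ws" if "i < n" for i
    using that assms(3) n_def by (metis nth_mem)
  have ws: "ws ! i \<in> set vs" if "i < n" for i
    using that assms(3) n' by (metis nth_mem)
  have [simp]: "vs ! i = vs ! j \<longleftrightarrow> i = j" "ws ! i = ws ! j \<longleftrightarrow> i = j"
    if "i < n" "j < n" for i j
    using that assms(1,2) n' n_def by (auto simp: nth_eq_iff_index_eq)
  have sum_vs: "(\<Sum>k = 0..<n. f (vs ! k)) = sum f (set vs)" for f :: "'a \<Rightarrow> int"
    using sum_enum[OF assms(1)] by (simp add: n_def)
  have sum_ws: "(\<Sum>k = 0..<n. f (ws ! k)) = sum f (set ws)" for f :: "'a \<Rightarrow> int"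
    using sum_enum[OF assms(2)] by (simp add: n')
  have [simp]: "P \<in> carrier_mat n n" "Q \<in> carrier_mat n n"
    "adjacency_mat G vs \<in> carrier_mat n n" "adjacency_mat G ws \<in> carrier_mat n n"
    by (auto simp: P_def Q_def adjacency_mat_def n_def[symmetric] n')
  have PQ: "P * Q = 1\<^sub>m n"
  proof (rule eq_matI)
    fix i j assume "i < dim_row (1\<^sub>m n :: int mat)" "j < dim_col (1\<^sub>m n :: int mat)"
    then have ij: "i < n" "j < n" by auto
    then have "(P * Q) $$ (i, j) = (\<Sum>k = 0..<n. (if vs ! i = ws ! k then 1 else 0) *
        (if ws ! k = vs ! j then 1 else 0))"
      by (simp add: P_def Q_def scalar_prod_def)
    also have "\<dots> = (\<Sum>w \<in> set ws. (if vs ! i = w then 1 else 0) * (if w = vs ! j then 1 else 0))"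
      by (rule sum_ws)
    also have "\<dots> = (\<Sum>w \<in> set ws. if vs ! i = w then (if w = vs ! j then 1 else 0) else 0)"
      by (intro sum.cong) auto
    finally show "(P * Q) $$ (i, j) = 1\<^sub>m n $$ (i, j)"
      using ij by (simp add: vs)
  qed (auto simp: P_def Q_def)
  have QP: "Q * P = 1\<^sub>m n"
  proof (rule eq_matI)
    fix i j assume "i < dim_row (1\<^sub>m n :: int mat)" "j < dim_col (1\<^sub>m n :: int mat)"
    then have ij: "i < n" "j < n" by auto
    then have "(Q * P) $$ (i, j) = (\<Sum>k = 0..<n. (if ws ! i = vs ! k then 1 else 0) *
        (if vs ! k = ws ! j then 1 else 0))"
      by (simp add: P_def Q_def scalar_prod_def)
    also have "\<dots> = (\<Sum>w \<in> set vs. (if ws ! i = w then 1 else 0) * (if w = ws ! j then 1 else 0))"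
      by (rule sum_vs)
    also have "\<dots> = (\<Sum>w \<in> set vs. if ws ! i = w then (if w = ws ! j then 1 else 0) else 0)"
      by (intro sum.cong) auto
    finally show "(Q * P) $$ (i, j) = 1\<^sub>m n $$ (i, j)"
      using ij by (simp add: ws)
  qed (auto simp: P_def Q_def)
  have PA: "P * adjacency_mat G ws =
      mat n n (\<lambda>(i, j). if (vs ! i, ws ! j) \<in> parcs G then 1 else 0)"
  proof (rule eq_matI, goal_cases)
    case (1 i j)
    then have ij: "i < n" "j < n" by auto
    then have "(P * adjacency_mat G ws) $$ (i, j) = (\<Sum>k = 0..<n. (if vs ! i = ws ! k then 1 else 0) *
        (if (ws ! k, ws ! j) \<in> parcs G then 1 else 0))"
      by (simp add: P_def adjacency_mat_def n' scalar_prod_def)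
    also have "\<dots> = (\<Sum>w \<in> set ws. (if vs ! i = w then 1 else 0) *
        (if (w, ws ! j) \<in> parcs G then 1 else 0))"
      by (rule sum_ws)
    also have "\<dots> = (\<Sum>w \<in> set ws. if vs ! i = w then (if (w, ws ! j) \<in> parcs G then 1 else 0) else 0)"
      by (intro sum.cong) auto
    finally show ?case
      using ij by (simp add: vs)
  qed (auto simp: P_def adjacency_mat_def n')
  have "P * adjacency_mat G ws * Q = adjacency_mat G vs"
  proof (rule eq_matI, goal_cases)
    case (1 i j)
    then have ij: "i < n" "j < n" by (auto simp: adjacency_mat_def n_def)
    then have "(P * adjacency_mat G ws * Q) $$ (i, j) =
        (\<Sum>k = 0..<n. (if (vs ! i, ws ! k) \<in> parcs G then 1 else 0) *
          (if ws ! k = vs ! j then 1 else 0))"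
      unfolding PA by (simp add: Q_def scalar_prod_def)
    also have "\<dots> = (\<Sum>w \<in> set ws. (if (vs ! i, w) \<in> parcs G then 1 else 0) *
        (if w = vs ! j then 1 else 0))"
      by (rule sum_ws)
    also have "\<dots> = (\<Sum>w \<in> set ws. if w = vs ! j then (if (vs ! i, w) \<in> parcs G then 1 else 0) else 0)"
      by (intro sum.cong) auto
    finally show ?case
      using ij by (simp add: vs adjacency_mat_def n_def[symmetric])
  qed (auto simp: P_def Q_def adjacency_mat_def n_def)
  then show "similar_mat (adjacency_mat G vs) (adjacency_mat G ws)"
    unfolding similar_mat_def
    by (intro exI[of _ P] exI[of _ Q] similar_mat_witI[of _ _ n]) (auto simp: PQ QP)
qed

lemma graph_char_poly_eq:
  assumes "distinct vs" "set vs = pverts G"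
  shows "graph_char_poly G = char_poly (adjacency_mat G vs)"
proof -
  have "finite (pverts G)" using assms by (metis List.finite_set)
  from vertex_enum[OF this] assms show ?thesis
    unfolding graph_char_poly_def by (intro char_poly_adjacency_mat_cong) auto
qed

end

theory Submission
  imports Defs
begin

text \<open>
  Write \<open>M = y I - A\<close> for the adjacency matrix \<open>A\<close> of \<open>G\<close> on \<open>n\<close> vertices, \<open>\<phi> = det M\<close>, and let
  \<open>S\<close> be the sum of all entries of the adjugate of \<open>M\<close>. The complement has adjacency
  matrix \<open>J - I - A\<close>, where \<open>J\<close> is the all-ones matrix, so its characteristic polynomial at \<open>x\<close>
  is, up to the sign \<open>(-1)^n\<close>, the value of \<open>det (M + J) = \<phi> + S\<close> at \<open>y = -1 - x\<close>
  (\<open>char_poly_complement\<close>). It therefore suffices that \<open>\<phi>\<close> modulo 4 determines \<open>S\<close> modulo 4.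
  This follows from the congruence

  \<open>\<phi>(y\<^sup>2)\<^sup>2 = \<phi>(y)\<^sup>2 * ((1 - n) * \<phi>(y\<^sup>2) + y\<^sup>2 * S(y\<^sup>2))\<close> modulo 4

  of \<open>char_poly_adj_sum_mod4\<close>: as \<open>\<phi>\<close> is monic, it is not a zero divisor modulo 4, and the
  congruence can be solved for \<open>S(y\<^sup>2)\<close>.

  The congruence comes from diagonalising \<open>M\<close>. Suppose \<open>P M P\<^sup>T\<close> is diagonal with entries \<open>d_i\<close> and
  \<open>P\<close> is unitriangular, and let \<open>F\<close> be the substitution of \<open>y\<^sup>2\<close> for \<open>y\<close>, for which \<open>F p = p\<^sup>2\<close>
  modulo 2. Every factor of \<open>F \<phi> / \<phi>\<^sup>2 = \<Prod> (F d_i / d_i\<^sup>2)\<close> is 1 modulo 2, so modulo 4 the product is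
  \<open>1 - n + \<Sum> F d_i / d_i\<^sup>2\<close>, and each summand may be inverted. On the other side
  \<open>y\<^sup>2 * F S / F \<phi> = \<Sum> (y * F r_i)\<^sup>2 / F d_i\<close> with \<open>r_i\<close> the \<open>i\<close>-th row sum of \<open>P\<close>. Both sums agree
  modulo 4 because \<open>y * F r_i = d_i\<close> modulo 2: in \<open>d_i = \<Sum> P_ij P_ik M_jk\<close> the terms with \<open>j \<noteq> k\<close>
  cancel in pairs by symmetry, and the remaining ones give \<open>y * \<Sum> P_ij\<^sup>2\<close>, which modulo 2 is
  \<open>y * r_i\<^sup>2\<close>.

  To stay inside \<open>\<int>[y]\<close>, the diagonalisation is carried out without division, one leading principal
  block at a time: \<open>d_i\<close> is a quotient of consecutive leading minors, and the \<open>i\<close>-th row of \<open>P\<close>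
  is proportional to the last row of the adjugate of the \<open>i\<close>-th block. The contribution of this row is
  \<open>adj_sum_recursion\<close>, its parity is \<open>last_row_sum_parity\<close>, and \<open>mod4_recursion_step\<close> assembles
  the induction.
\<close>

section \<open>Adjugates of nested symmetric matrices\<close>

text \<open>
  The entries come from a function on all pairs of indices, so that the blocks of one function are
  nested and an induction on the size can compare the block of size \<open>n + 1\<close> with that of size \<open>n\<close>.
\<close>

definition block :: "nat \<Rightarrow> (nat \<Rightarrow> nat \<Rightarrow> 'a) \<Rightarrow> 'a mat" where
  "block n f = mat n n (\<lambda>(i, j). f i j)"

text \<open>
  With \<open>e\<close> the all-ones vector this is \<open>e\<^sup>T adj(X) e\<close>; for \<open>X = y I - A\<close> the quotient
  \<open>adj_sum X / det X\<close> is the generating function of the numbers of walks.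
\<close>

definition adj_sum :: "'a :: comm_ring_1 mat \<Rightarrow> 'a" where
  "adj_sum X = (\<Sum>i<dim_row X. \<Sum>j<dim_row X. adj_mat X $$ (i, j))"

lemma block_carrier [simp]: "block n f \<in> carrier_mat n n"
  and dim_block [simp]: "dim_row (block n f) = n" "dim_col (block n f) = n"
  and index_block [simp]: "i < n \<Longrightarrow> j < n \<Longrightarrow> block n f $$ (i, j) = f i j"
  by (simp_all add: block_def)

lemma adj_mat_dims [simp]:
  "dim_row (adj_mat X) = dim_row X" "dim_col (adj_mat X) = dim_col X"
  by (simp_all add: adj_mat_def)

lemma block_times_adj:
  fixes f :: "nat \<Rightarrow> nat \<Rightarrow> 'a :: comm_ring_1"
  assumes "i < n" "k < n"
  shows "(\<Sum>j<n. f i j * adj_mat (block n f) $$ (j, k)) = (if i = k then det (block n f) else 0)"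
proof -
  have "(block n f * adj_mat (block n f)) $$ (i, k) = (det (block n f) \<cdot>\<^sub>m 1\<^sub>m n) $$ (i, k)"
    using adj_mat(2)[OF block_carrier, of n f] by simp
  then show ?thesis
    using assms by (simp add: scalar_prod_def atLeast0LessThan)
qed

lemma adj_times_block:
  fixes f :: "nat \<Rightarrow> nat \<Rightarrow> 'a :: comm_ring_1"
  assumes "i < n" "k < n"
  shows "(\<Sum>j<n. adj_mat (block n f) $$ (i, j) * f j k) = (if i = k then det (block n f) else 0)"
proof -
  have "(adj_mat (block n f) * block n f) $$ (i, k) = (det (block n f) \<cdot>\<^sub>m 1\<^sub>m n) $$ (i, k)"
    using adj_mat(3)[OF block_carrier, of n f] by simp
  then show ?thesis
    using assms by (simp add: scalar_prod_def atLeast0LessThan)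
qed

lemma adj_block_symmetric:
  fixes f :: "nat \<Rightarrow> nat \<Rightarrow> 'a :: comm_ring_1"
  assumes sym: "\<And>i j. f i j = f j i" and "i < n" "j < n"
  shows "adj_mat (block n f) $$ (i, j) = adj_mat (block n f) $$ (j, i)"
proof -
  have "mat_delete (block n f) i j = transpose_mat (mat_delete (block n f) j i)"
    by (rule eq_matI) (simp_all add: mat_delete_def block_def, blast intro: sym)
  moreover have "mat_delete (block n f) j i \<in> carrier_mat (n - 1) (n - 1)"
    by (rule mat_delete_carrier) simp
  ultimately have "det (mat_delete (block n f) i j) = det (mat_delete (block n f) j i)"
    by (simp add: det_transpose)
  then show ?thesis
    using assms(2,3) by (simp add: adj_mat_def cofactor_def add.commute)
qed

lemma adj_block_corner:
  fixes f :: "nat \<Rightarrow> nat \<Rightarrow> 'a :: comm_ring_1"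
  shows "adj_mat (block (Suc n) f) $$ (n, n) = det (block n f)"
proof -
  have "mat_delete (block (Suc n) f) n n = block n f"
    by (rule eq_matI) (auto simp: mat_delete_def block_def)
  then show ?thesis
    by (simp add: adj_mat_def cofactor_def)
qed

text \<open>
  Up to the factor \<open>det (block n f) * det (block (Suc n) f)\<close> this compares \<open>e\<^sup>T X\<^sup>-\<^sup>1 e\<close> for two
  consecutive blocks \<open>X\<close>. The solutions of \<open>X x = e\<close> in the two sizes, the smaller one padded by
  a zero, differ by a vector that \<open>X\<close> sends to a multiple of the last unit vector. Hence their
  difference is a multiple of the last column of the adjugate, and the multiple can be read off
  from the last coordinate.
\<close>

lemma adj_sum_recursion:
  fixes f :: "nat \<Rightarrow> nat \<Rightarrow> 'a :: idom"
  assumes sym: "\<And>i j. f i j = f j i"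
    and nz: "det (block n f) \<noteq> 0" "det (block (Suc n) f) \<noteq> 0"
  shows "adj_sum (block (Suc n) f) * det (block n f) - adj_sum (block n f) * det (block (Suc n) f)
    = (\<Sum>j<Suc n. adj_mat (block (Suc n) f) $$ (n, j))\<^sup>2"
proof -
  define d d' where "d = det (block (Suc n) f)" and "d' = det (block n f)"
  define N N' where "N = adj_mat (block (Suc n) f)" and "N' = adj_mat (block n f)"
  define x x' where "x i = (\<Sum>j<Suc n. N $$ (i, j))" and "x' i = (\<Sum>j<n. N' $$ (i, j))" for i
  \<comment> \<open>The two solutions of \<open>X x = e\<close> satisfy \<open>X x = d e\<close> and \<open>X' x' = d' e\<close> when written without
    denominators; \<open>u\<close> is their difference, the smaller one padded by a zero.\<close>
  define u where "u i = d' * x i - (if i < n then d * x' i else 0)" for i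
  define c where "c = (\<Sum>k<Suc n. f n k * u k)"
  have fx: "(\<Sum>k<Suc n. f i k * x k) = d" if "i < Suc n" for i
  proof -
    have "(\<Sum>k<Suc n. f i k * x k) = (\<Sum>j<Suc n. \<Sum>k<Suc n. f i k * N $$ (k, j))"
      unfolding x_def sum_distrib_left by (rule sum.swap)
    also have "\<dots> = (\<Sum>j<Suc n. if i = j then d else 0)"
      unfolding N_def d_def by (intro sum.cong refl block_times_adj that) auto
    finally show ?thesis using that by (simp del: sum.lessThan_Suc)
  qed
  have fx': "(\<Sum>k<n. f i k * x' k) = d'" if "i < n" for i
  proof -
    have "(\<Sum>k<n. f i k * x' k) = (\<Sum>j<n. \<Sum>k<n. f i k * N' $$ (k, j))"
      unfolding x'_def sum_distrib_left by (rule sum.swap)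
    also have "\<dots> = (\<Sum>j<n. if i = j then d' else 0)"
      unfolding N'_def d'_def by (intro sum.cong refl block_times_adj that) auto
    finally show ?thesis using that by simp
  qed
  have fu: "(\<Sum>k<Suc n. f i k * u k) = (if i = n then c else 0)" if "i < Suc n" for i
  proof (cases "i = n")
    case False
    then have i: "i < n" using that by simp
    have "(\<Sum>k<Suc n. f i k * u k)
        = d' * (\<Sum>k<Suc n. f i k * x k) - d * (\<Sum>k<n. f i k * x' k)"
      by (simp add: u_def algebra_simps sum_subtractf sum_distrib_left)
    also have "\<dots> = 0"
      using fx[OF that] fx'[OF i] by simp
    finally show ?thesis using False by simp
  qed (simp add: c_def)
  have du: "d * u i = N $$ (i, n) * c" if "i < Suc n" for i
  proof -
    have "d * u i = (\<Sum>k<Suc n. (if i = k then d else 0) * u k)"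
      using that by (simp del: sum.lessThan_Suc add: if_distrib[of "\<lambda>z. z * _"] cong: if_cong)
    also have "\<dots> = (\<Sum>k<Suc n. (\<Sum>j<Suc n. N $$ (i, j) * f j k) * u k)"
      unfolding N_def d_def
      by (intro sum.cong refl arg_cong2[where f = "(*)"] adj_times_block[symmetric] that) auto
    also have "\<dots> = (\<Sum>j<Suc n. N $$ (i, j) * (\<Sum>k<Suc n. f j k * u k))"
      unfolding sum_distrib_left sum_distrib_right by (subst sum.swap) (simp only: mult.assoc)
    also have "\<dots> = (\<Sum>j<Suc n. N $$ (i, j) * (if j = n then c else 0))"
      by (intro sum.cong refl arg_cong2[where f = "(*)"] fu) auto
    also have "\<dots> = N $$ (i, n) * c" by simp
    finally show ?thesis .
  qed
  have "d * (d' * x n) = d' * c"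
    using du[of n] adj_block_corner[of n f] by (simp add: u_def N_def d'_def)
  then have c: "c = d * x n"
    using nz by (simp add: d'_def mult.left_commute)
  have u: "u i = N $$ (i, n) * x n" if "i < Suc n" for i
    using du[OF that] nz by (simp add: c d_def mult.left_commute)
  have "(\<Sum>i<Suc n. u i) = (\<Sum>i<Suc n. N $$ (i, n)) * x n"
    unfolding sum_distrib_right by (intro sum.cong refl u) auto
  also have "(\<Sum>i<Suc n. N $$ (i, n)) = x n"
    unfolding x_def N_def by (intro sum.cong refl adj_block_symmetric sym) auto
  finally have "(\<Sum>i<Suc n. u i) = (x n)\<^sup>2"
    by (simp add: power2_eq_square)
  moreover have "(\<Sum>i<Suc n. u i) = d' * (\<Sum>i<Suc n. x i) - d * (\<Sum>i<n. x' i)"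
    by (simp add: u_def algebra_simps sum_subtractf sum_distrib_left)
  ultimately show ?thesis
    by (simp add: adj_sum_def x_def x'_def N_def N'_def d_def d'_def mult.commute
        del: sum.lessThan_Suc)
qed

text \<open>
  The bordered matrix with blocks \<open>X\<close>, \<open>-e\<close>, \<open>e\<^sup>T\<close>, \<open>1\<close> is computed in two ways: clearing its last
  row leaves \<open>X + e e\<^sup>T\<close> in the corner, while clearing its last column, at the price of a factor
  \<open>det X\<close>, leaves \<open>X\<close> and the scalar \<open>det X + e\<^sup>T adj(X) e\<close>.
\<close>

lemma det_add_all_ones:
  fixes X :: "'a :: idom mat"
  assumes X: "X \<in> carrier_mat n n" and nz: "det X \<noteq> 0"
  shows "det (X + mat n n (\<lambda>_. 1)) = det X + adj_sum X"
proof -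
  define e where "e = mat n 1 (\<lambda>_. 1 :: 'a)"
  define e' where "e' = mat 1 n (\<lambda>_. 1 :: 'a)"
  define o1 where "o1 = (1\<^sub>m 1 :: 'a mat)"
  define N where "N = adj_mat X"
  define B where "B = four_block_mat X (- e) e' o1"
  define C where "C = four_block_mat (1\<^sub>m n) (0\<^sub>m n 1) (- e') o1"
  define D where "D = four_block_mat (1\<^sub>m n) (N * e) (0\<^sub>m 1 n) (det X \<cdot>\<^sub>m o1)"
  have N: "N \<in> carrier_mat n n" and XN: "X * N = det X \<cdot>\<^sub>m 1\<^sub>m n"
    using adj_mat[OF X] by (simp_all add: N_def)
  have vecs: "e \<in> carrier_mat n 1" "e' \<in> carrier_mat 1 n" "o1 \<in> carrier_mat 1 1"
    by (auto simp: e_def e'_def o1_def)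
  note [simp] = X N vecs vecs[unfolded One_nat_def]
  have BC: "B * C = four_block_mat (X + mat n n (\<lambda>_. 1)) (- e) (0\<^sub>m 1 n) o1"
  proof -
    have "X * 1\<^sub>m n + - e * - e' = X + mat n n (\<lambda>_. 1)"
      unfolding right_mult_one_mat[OF X]
      by (rule eq_matI) (use X in \<open>auto simp: e_def e'_def scalar_prod_def\<close>)
    moreover have "X * 0\<^sub>m n 1 + - e * o1 = - e"
      unfolding right_mult_zero_mat[OF X]
      by (rule eq_matI) (use X in \<open>auto simp: e_def o1_def scalar_prod_def\<close>)
    moreover have "e' * 1\<^sub>m n + o1 * - e' = 0\<^sub>m 1 n"
      by (rule eq_matI) (auto simp: e'_def o1_def scalar_prod_def)
    moreover have "e' * 0\<^sub>m n 1 + o1 * o1 = o1"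
      by (rule eq_matI) (auto simp: e'_def o1_def scalar_prod_def)
    ultimately show ?thesis
      unfolding B_def C_def by (subst mult_four_block_mat[of _ n n _ 1 _ 1 _ _ n _ 1]) auto
  qed
  have [simp]: "N * e \<in> carrier_mat n (Suc 0)"
    using mult_carrier_mat[OF N vecs(1)] by simp
  have BD: "B * D = four_block_mat X (0\<^sub>m n 1) e' ((adj_sum X + det X) \<cdot>\<^sub>m o1)"
  proof -
    have "X * (N * e) = det X \<cdot>\<^sub>m e"
      unfolding assoc_mult_mat[OF X N vecs(1), symmetric] XN
      by (simp add: mult_smult_assoc_mat[of _ n n _ 1] left_mult_one_mat[OF vecs(1)]
          del: One_nat_def)
    then have "X * (N * e) + - e * (det X \<cdot>\<^sub>m o1) = 0\<^sub>m n 1"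
      by (intro eq_matI) (auto simp: e_def o1_def scalar_prod_def)
    moreover have "e' * (N * e) + o1 * (det X \<cdot>\<^sub>m o1) = (adj_sum X + det X) \<cdot>\<^sub>m o1"
      by (intro eq_matI)
        (auto simp: e_def e'_def o1_def scalar_prod_def adj_sum_def N_def atLeast0LessThan
          carrier_matD[OF X])
    moreover have "X * 1\<^sub>m n + - e * 0\<^sub>m 1 n = X"
      unfolding right_mult_one_mat[OF X]
      by (rule eq_matI) (use X in \<open>auto simp: e_def scalar_prod_def\<close>)
    moreover have "e' * 1\<^sub>m n + o1 * 0\<^sub>m 1 n = e'"
      by (rule eq_matI) (auto simp: e'_def o1_def scalar_prod_def)
    ultimately show ?thesis
      unfolding B_def D_def by (subst mult_four_block_mat[of _ n n _ 1 _ 1 _ _ n _ 1]) auto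
  qed
  have BCD: "B \<in> carrier_mat (n + 1) (n + 1)" "C \<in> carrier_mat (n + 1) (n + 1)"
    "D \<in> carrier_mat (n + 1) (n + 1)"
    unfolding B_def C_def D_def by (intro four_block_carrier_mat; simp)+
  have detC: "det C = 1"
    unfolding C_def by (subst det_four_block_mat_upper_right_zero[of _ n _ 1]) (auto simp: o1_def)
  have detD: "det D = det X"
    unfolding D_def by (subst det_four_block_mat_lower_left_zero[of _ n _ 1]) (auto simp: o1_def)
  have "det B = det (B * C)"
    using detC by (simp add: det_mult[OF BCD(1,2)])
  also have "\<dots> = det (X + mat n n (\<lambda>_. 1))"
    unfolding BC by (subst det_four_block_mat_lower_left_zero[of _ n _ 1]) (auto simp: o1_def)
  finally have "det (X + mat n n (\<lambda>_. 1)) = det B" ..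
  moreover have "det B * det X = det X * (adj_sum X + det X)"
  proof -
    have "det B * det X = det (B * D)"
      using detD by (simp add: det_mult[OF BCD(1,3)])
    also have "\<dots> = det X * (adj_sum X + det X)"
      unfolding BD by (subst det_four_block_mat_upper_right_zero[of _ n _ 1]) (auto simp: o1_def)
    finally show ?thesis .
  qed
  ultimately show ?thesis
    using nz by (simp add: mult.commute add.commute)
qed

section \<open>Parity\<close>

lemma even_symmetric_double_sum:
  fixes g :: "nat \<Rightarrow> nat \<Rightarrow> 'a :: comm_ring_1"
  assumes sym: "\<And>i j. i < n \<Longrightarrow> j < n \<Longrightarrow> g i j = g j i" and diag: "\<And>i. i < n \<Longrightarrow> 2 dvd g i i"
  shows "2 dvd (\<Sum>i<n. \<Sum>j<n. g i j)"
  using assms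
proof (induction n)
  case (Suc n)
  have "(\<Sum>i<n. g i n) = (\<Sum>j<n. g n j)"
    using Suc.prems(1) by (intro sum.cong) auto
  then have "(\<Sum>i<Suc n. \<Sum>j<Suc n. g i j)
      = (\<Sum>i<n. \<Sum>j<n. g i j) + 2 * (\<Sum>j<n. g n j) + g n n"
    by (simp add: sum.distrib algebra_simps)
  moreover have "2 dvd (\<Sum>i<n. \<Sum>j<n. g i j)"
    using Suc by simp
  ultimately show ?case
    using Suc.prems(2)[of n] by (metis dvd_add dvd_triv_left lessI)
qed simp

text \<open>
  Let \<open>a\<close> be the last row of the adjugate of \<open>X\<close>, the larger block. Then
  \<open>a X a\<^sup>T = det X * a_n\<close>, and \<open>a_n\<close> is the smaller determinant. Modulo 2 only the diagonal terms
  \<open>a_j\<^sup>2 * y\<close> of this quadratic form survive, and only these survive in \<open>y * (\<Sum> a_j)\<^sup>2\<close>.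
\<close>

lemma last_row_sum_parity:
  fixes f :: "nat \<Rightarrow> nat \<Rightarrow> 'a :: comm_ring_1"
  assumes sym: "\<And>i j. f i j = f j i" and diag: "\<And>i. 2 dvd y - f i i"
  shows "2 dvd y * (\<Sum>j<Suc n. adj_mat (block (Suc n) f) $$ (n, j))\<^sup>2
    - det (block (Suc n) f) * det (block n f)"
proof -
  define N where "N = adj_mat (block (Suc n) f)"
  define a where "a j = N $$ (n, j)" for j
  have symN: "N $$ (j, n) = a j" if "j < Suc n" for j
    using that unfolding a_def N_def by (intro adj_block_symmetric sym) auto
  have "det (block (Suc n) f) * det (block n f) = det (block (Suc n) f) * a n"
    by (simp add: a_def N_def adj_block_corner)
  also have "\<dots> = (\<Sum>j<Suc n. (if n = j then det (block (Suc n) f) else 0) * a j)"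
    by (simp add: if_distrib[of "\<lambda>z. z * _"] cong: if_cong)
  also have "\<dots> = (\<Sum>j<Suc n. (\<Sum>i<Suc n. a i * f i j) * a j)"
    unfolding a_def N_def
    by (intro sum.cong refl arg_cong2[where f = "(*)"] adj_times_block[symmetric]) auto
  also have "\<dots> = (\<Sum>j<Suc n. \<Sum>i<Suc n. a j * a i * f j i)"
    unfolding sum_distrib_right by (intro sum.cong refl) (simp add: sym mult_ac)
  finally have "det (block (Suc n) f) * det (block n f)
      = (\<Sum>j<Suc n. \<Sum>i<Suc n. a j * a i * f j i)" .
  moreover have "y * (\<Sum>j<Suc n. a j)\<^sup>2 = (\<Sum>j<Suc n. \<Sum>i<Suc n. a j * a i * y)"
    unfolding power2_eq_square sum_product by (simp only: sum_distrib_left mult_ac)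
  ultimately have "y * (\<Sum>j<Suc n. a j)\<^sup>2 - det (block (Suc n) f) * det (block n f)
      = (\<Sum>j<Suc n. \<Sum>i<Suc n. a j * a i * (y - f j i))"
    by (simp only: right_diff_distrib sum_subtractf)
  moreover have "2 dvd (\<Sum>j<Suc n. \<Sum>i<Suc n. a j * a i * (y - f j i))"
  proof (rule even_symmetric_double_sum)
    show "a i * a j * (y - f i j) = a j * a i * (y - f j i)" for i j
      by (simp add: sym[of i j] mult_ac)
    show "2 dvd a i * a i * (y - f i i)" for i
      using diag[of i] by simp
  qed
  ultimately show ?thesis
    by (simp add: a_def N_def)
qed

section \<open>Congruences of integer polynomials\<close>

lemma numeral_dvd_poly_iff:
  fixes p :: "int poly"
  shows "numeral c dvd p \<longleftrightarrow> (\<forall>k. numeral c dvd coeff p k)"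
  by (simp add: numeral_poly const_poly_dvd_iff)

text \<open>
  The leading coefficient of \<open>q\<close> is that of \<open>p * q\<close>, so its leading term is divisible by the
  modulus and can be removed from \<open>q\<close>.
\<close>

lemma dvd_cancel_monic:
  fixes p q :: "int poly"
  assumes "lead_coeff p = 1" "numeral c dvd p * q"
  shows "numeral c dvd q"
  using assms(2)
proof (induction "degree q" arbitrary: q rule: less_induct)
  case less
  define m where "m = monom (lead_coeff q) (degree q)"
  have "numeral c dvd coeff (p * q) (degree p + degree q)"
    using less.prems unfolding numeral_dvd_poly_iff by blast
  then have "numeral c dvd lead_coeff q"
    by (simp add: coeff_mult_degree_sum assms(1))
  then have m: "numeral c dvd m"
    by (simp add: m_def numeral_dvd_poly_iff)
  have "numeral c dvd q - m"
  proof (cases "q - m = 0")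
    case False
    have le: "degree (q - m) \<le> degree q"
      unfolding m_def by (intro degree_diff_le degree_monom_le) simp
    moreover have "coeff (q - m) (degree q) = 0"
      by (simp add: m_def)
    ultimately have "degree (q - m) < degree q"
      using False by (metis leading_coeff_0_iff le_neq_implies_less)
    moreover have "numeral c dvd p * (q - m)"
      using less.prems m by (simp add: right_diff_distrib)
    ultimately show ?thesis by (rule less.hyps)
  qed simp
  with m show ?case by (metis diff_add_cancel dvd_add)
qed

lemma monic_cong_imp_degree_eq:
  fixes p q :: "int poly"
  assumes "lead_coeff p = 1" "lead_coeff q = 1" and cong: "4 dvd p - q"
  shows "degree p = degree q"
proof (rule linorder_cases[of "degree p" "degree q"])
  have c: "4 dvd coeff p k - coeff q k" for k
    using cong by (simp add: numeral_dvd_poly_iff)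
  show ?thesis if "degree p < degree q"
    using c[of "degree q"] assms(2) that by (simp add: coeff_eq_0)
  show ?thesis if "degree q < degree p"
    using c[of "degree p"] assms(1) that by (simp add: coeff_eq_0)
qed

abbreviation sq_var :: "int poly \<Rightarrow> int poly" where
  "sq_var p \<equiv> p \<circ>\<^sub>p [:0, 0, 1:]"

lemma coeff_sq_var_even: "coeff (sq_var p) (2 * i) = coeff p i"
proof (induction p arbitrary: i)
  case (pCons a p)
  then show ?case
    by (cases i) (simp_all add: pcompose_pCons)
qed simp

text \<open>
  Modulo 2, squaring is additive and fixes the coefficients, so it only squares the variable.
\<close>

lemma sq_var_frobenius: "2 dvd sq_var p - p\<^sup>2"
proof (induction p)
  case (pCons a p)
  define c x where "c = [:a:]" and "x = [:0, 1 :: int:]"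
  have "c - c\<^sup>2 = [:a - a\<^sup>2:]"
    by (simp add: c_def power2_eq_square)
  then have c: "2 dvd c - c\<^sup>2"
    by (simp add: numeral_poly const_poly_dvd)
  have "pCons a p = c + x * p" "sq_var (pCons a p) = c + x\<^sup>2 * sq_var p"
    by (simp_all add: c_def x_def pcompose_pCons power2_eq_square)
  then have "sq_var (pCons a p) - (pCons a p)\<^sup>2
      = (c - c\<^sup>2) - 2 * (c * x * p) + x\<^sup>2 * (sq_var p - p\<^sup>2)"
    by (simp add: power2_eq_square algebra_simps)
  then show ?case
    using pCons.IH c by (metis dvd_add dvd_diff dvd_mult dvd_triv_left)
qed simp

text \<open>
  The inductive step of the congruence described at the top. The letters \<open>g'\<close>, \<open>g\<close> stand for
  consecutive leading minors of \<open>y I - A\<close>, and \<open>f'\<close>, \<open>f\<close>, \<open>s'\<close>, \<open>s\<close> for their images and those of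
  \<open>adj_sum\<close>, multiplied by \<open>y\<^sup>2\<close>, under the substitution of \<open>y\<^sup>2\<close>. In terms of the ratios
  \<open>f / g\<^sup>2\<close> and \<open>f' / g'\<^sup>2\<close>, which are 1 modulo 2, the step is
  \<open>(1 + 2 \<alpha>) (1 + 2 \<beta>) = 1 + 2 \<alpha> + 2 \<beta>\<close> modulo 4. The square \<open>r\<^sup>2\<close> may be replaced by
  \<open>(g * g')\<^sup>2\<close>, since a square modulo 4 depends only on its root modulo 2. The factor
  \<open>f' * g'\<^sup>2\<close> in the conclusion clears the denominators.
\<close>

lemma mod4_recursion_step:
  fixes f f' g g' r s s' :: "'a :: comm_ring_1"
  assumes "2 dvd f - g\<^sup>2" "2 dvd f' - g'\<^sup>2" "2 dvd r - g * g'"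
    and rec: "s * f' - s' * f = r\<^sup>2"
    and IH: "4 dvd f'\<^sup>2 - g'\<^sup>2 * ((k + 1) * f' + s')"
  shows "4 dvd f' * g'\<^sup>2 * (f\<^sup>2 - g\<^sup>2 * (k * f + s))"
proof -
  from assms(1-3) obtain a b c where f: "f - g\<^sup>2 = 2 * a" and f': "f' - g'\<^sup>2 = 2 * b"
    and r: "r - g * g' = 2 * c"
    unfolding dvd_def by blast
  from IH obtain e where e: "f'\<^sup>2 - g'\<^sup>2 * ((k + 1) * f' + s') = 4 * e"
    unfolding dvd_def by blast
  define u v where "u = g\<^sup>2" and "v = g'\<^sup>2"
  have f: "f = u + 2 * a" and f': "f' = v + 2 * b"
    using f f' by (simp_all add: u_def v_def algebra_simps)
  have "r\<^sup>2 = (g * g' + 2 * c)\<^sup>2"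
    using r by (simp add: algebra_simps)
  also have "\<dots> = u * v + 4 * (g * g' * c + c\<^sup>2)"
    by (simp add: u_def v_def power2_eq_square algebra_simps)
  finally have sf: "s * f' = s' * f + (u * v + 4 * (g * g' * c + c\<^sup>2))"
    using rec by (simp add: algebra_simps)
  have vs': "v * s' = f'\<^sup>2 - (k + 1) * v * f' - 4 * e"
    using e by (simp add: v_def algebra_simps)
  have "f' * v * (f\<^sup>2 - u * (k * f + s))
      = f' * v * f\<^sup>2 - k * u * v * f * f' - u * v * (s * f')"
    by (simp add: algebra_simps)
  also have "\<dots> = f' * v * f\<^sup>2 - k * u * v * f * f' - u * f * (v * s')
      - u * v * (u * v + 4 * (g * g' * c + c\<^sup>2))"
    unfolding sf by (simp add: algebra_simps)
  also have "\<dots> = f * f' * (v * f - u * f' + u * v) - u\<^sup>2 * v\<^sup>2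
      + 4 * (u * f * e - u * v * (g * g' * c + c\<^sup>2))"
    unfolding vs' by (simp add: power2_eq_square algebra_simps)
  \<comment> \<open>With \<open>f * f' = u * v + 2 * \<sigma>\<close> and third factor \<open>u * v + 2 * \<tau>\<close>, the left side is
    \<open>2 * u * v * (\<sigma> + \<tau>) + 4 * \<sigma> * \<tau>\<close>, and \<open>\<sigma> + \<tau>\<close> is even.\<close>
  also have "f * f' * (v * f - u * f' + u * v) - u\<^sup>2 * v\<^sup>2
      = 4 * (u * v * (a * v + a * b) + (a * v + u * b + 2 * a * b) * (a * v - u * b))"
    unfolding f f' by (simp add: power2_eq_square algebra_simps)
  finally have "4 dvd f' * v * (f\<^sup>2 - u * (k * f + s))"
    by (metis dvd_add dvd_triv_left)
  then show ?thesis by (simp add: u_def v_def)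
qed

section \<open>Characteristic polynomials\<close>

lemma char_poly_matrix_block:
  "char_poly_matrix (block n a) = block n (\<lambda>i j. (if i = j then [:0, 1:] else 0) - [:a i j:])"
  by (rule eq_matI) (auto simp: char_poly_matrix_def block_def)

lemma monic_char_poly_block:
  fixes a :: "nat \<Rightarrow> nat \<Rightarrow> 'a :: comm_ring_1"
  shows "degree (char_poly (block n a)) = n" "lead_coeff (char_poly (block n a)) = 1"
  using degree_monic_char_poly[OF block_carrier, of n a] by auto

lemma lead_coeff_sq_var: "lead_coeff p = 1 \<Longrightarrow> lead_coeff (sq_var p) = 1"
  by (subst lead_coeff_comp) auto

text \<open>
  The leading blocks of a symmetric matrix with even diagonal are again of this kind, so the
  congruence is proved for all of them by induction on the size. The recursion for \<open>adj_sum\<close> is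
  multiplied by \<open>y\<^sup>2\<close> because the parity lemma controls \<open>y * r\<^sup>2\<close>, hence \<open>y * r(y\<^sup>2)\<close>, and not the
  row sum \<open>r\<close> itself.
\<close>

lemma char_poly_adj_sum_mod4:
  fixes a :: "nat \<Rightarrow> nat \<Rightarrow> int"
  assumes sym: "\<And>i j. a i j = a j i" and diag: "\<And>i. even (a i i)"
  defines "\<phi> \<equiv> \<lambda>n. char_poly (block n a)"
    and "S \<equiv> \<lambda>n. adj_sum (char_poly_matrix (block n a))"
  shows "4 dvd (sq_var (\<phi> n))\<^sup>2
    - (\<phi> n)\<^sup>2 * ((1 - of_nat n) * sq_var (\<phi> n) + [:0, 0, 1:] * sq_var (S n))"
proof (induction n)
  case 0
  have "\<phi> 0 = 1" unfolding \<phi>_def char_poly_def by (intro det_dim_zero) simp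
  moreover have "S 0 = 0" by (simp add: S_def adj_sum_def char_poly_matrix_def)
  ultimately show ?case by (simp add: pcompose_1)
next
  case (Suc n)
  define m where "m i j = (if i = j then [:0, 1:] else 0) - [:a i j:]" for i j
  have \<phi>: "\<phi> k = det (block k m)" and S: "S k = adj_sum (block k m)" for k
    unfolding \<phi>_def S_def char_poly_def char_poly_matrix_block m_def by simp_all
  have monic: "lead_coeff (\<phi> k) = 1" for k
    unfolding \<phi>_def by (rule monic_char_poly_block)
  then have nz: "\<phi> k \<noteq> 0" for k by (metis leading_coeff_0_iff zero_neq_one)
  have msym: "m i j = m j i" for i j by (simp add: m_def sym)
  define r where "r = (\<Sum>j<Suc n. adj_mat (block (Suc n) m) $$ (n, j))"
  define x where "x = [:0, 1 :: int:]"
  have x2: "x\<^sup>2 = [:0, 0, 1:]" by (simp add: x_def power2_eq_square)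
  have "2 dvd x - m i i" for i
    using diag[of i] by (simp add: m_def x_def numeral_poly const_poly_dvd)
  then have r2: "2 dvd x * r\<^sup>2 - \<phi> (Suc n) * \<phi> n"
    unfolding r_def \<phi> by (intro last_row_sum_parity msym)
  have "S (Suc n) * \<phi> n - S n * \<phi> (Suc n) = r\<^sup>2"
    unfolding r_def \<phi> S using nz by (intro adj_sum_recursion msym) (simp_all add: \<phi>)
  then have "sq_var (S (Suc n) * \<phi> n - S n * \<phi> (Suc n)) = sq_var (r\<^sup>2)" by simp
  then have rec: "(x\<^sup>2 * sq_var (S (Suc n))) * sq_var (\<phi> n)
      - (x\<^sup>2 * sq_var (S n)) * sq_var (\<phi> (Suc n)) = (x * sq_var r)\<^sup>2"
    by (simp add: pcompose_diff pcompose_mult power2_eq_square algebra_simps)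
  have "x * sq_var r - \<phi> (Suc n) * \<phi> n
      = x * (sq_var r - r\<^sup>2) + (x * r\<^sup>2 - \<phi> (Suc n) * \<phi> n)"
    by (simp add: algebra_simps)
  then have par: "2 dvd x * sq_var r - \<phi> (Suc n) * \<phi> n"
    using r2 sq_var_frobenius[of r] by (metis dvd_add dvd_mult)
  have "4 dvd (sq_var (\<phi> n))\<^sup>2
    - (\<phi> n)\<^sup>2 * ((- of_nat n + 1) * sq_var (\<phi> n) + x\<^sup>2 * sq_var (S n))"
    using Suc unfolding x2 by (simp add: algebra_simps)
  from mod4_recursion_step[OF sq_var_frobenius sq_var_frobenius par rec this]
  have "4 dvd sq_var (\<phi> n) * (\<phi> n)\<^sup>2 * ((sq_var (\<phi> (Suc n)))\<^sup>2
    - (\<phi> (Suc n))\<^sup>2 * (- of_nat n * sq_var (\<phi> (Suc n)) + x\<^sup>2 * sq_var (S (Suc n))))" .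
  moreover have "lead_coeff (sq_var (\<phi> n) * (\<phi> n)\<^sup>2) = 1"
    using monic[of n] lead_coeff_sq_var[OF monic[of n]]
    by (simp only: lead_coeff_mult lead_coeff_power) simp
  ultimately have "4 dvd (sq_var (\<phi> (Suc n)))\<^sup>2
    - (\<phi> (Suc n))\<^sup>2 * (- of_nat n * sq_var (\<phi> (Suc n)) + x\<^sup>2 * sq_var (S (Suc n)))"
    using dvd_cancel_monic by blast
  then show ?case unfolding x2 by simp
qed

text \<open>
  Subtracting the congruence for the two matrices leaves \<open>\<phi>\<^sup>2 * y\<^sup>2\<close> times the difference of the
  adjugate sums at \<open>y\<^sup>2\<close>, and the monic factor cancels.
\<close>

lemma adj_sum_determined_mod4:
  fixes a b :: "nat \<Rightarrow> nat \<Rightarrow> int"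
  assumes "\<And>i j. a i j = a j i" "\<And>i. even (a i i)"
    and "\<And>i j. b i j = b j i" "\<And>i. even (b i i)"
    and cong: "4 dvd char_poly (block n a) - char_poly (block n b)"
  shows "4 dvd adj_sum (char_poly_matrix (block n a)) - adj_sum (char_poly_matrix (block n b))"
proof -
  define p q where "p = char_poly (block n a)" and "q = char_poly (block n b)"
  define s t where "s = adj_sum (char_poly_matrix (block n a))"
    and "t = adj_sum (char_poly_matrix (block n b))"
  define k x :: "int poly" where "k = 1 - of_nat n" and "x = [:0, 0, 1:]"
  have "4 dvd (sq_var p)\<^sup>2 - p\<^sup>2 * (k * sq_var p + x * sq_var s)"
    unfolding p_def s_def k_def x_def by (intro char_poly_adj_sum_mod4 assms)
  then obtain e where e: "(sq_var p)\<^sup>2 - p\<^sup>2 * (k * sq_var p + x * sq_var s) = 4 * e"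
    unfolding dvd_def by blast
  have "4 dvd (sq_var q)\<^sup>2 - q\<^sup>2 * (k * sq_var q + x * sq_var t)"
    unfolding q_def t_def k_def x_def by (intro char_poly_adj_sum_mod4 assms)
  then obtain e' where e': "(sq_var q)\<^sup>2 - q\<^sup>2 * (k * sq_var q + x * sq_var t) = 4 * e'"
    unfolding dvd_def by blast
  from cong obtain d where "p - q = 4 * d"
    unfolding p_def q_def dvd_def by blast
  then have q: "p = q + 4 * d" by (simp add: algebra_simps)
  define D where "D = sq_var d"
  have sq: "sq_var p = sq_var q + 4 * D"
    by (simp add: q pcompose_add pcompose_smult D_def numeral_poly)
  have "q\<^sup>2 * x * (sq_var s - sq_var t) = 4 * (e' - e + 2 * sq_var q * D + 4 * D\<^sup>2
      - (q\<^sup>2 * k * D + (2 * q * d + 4 * d\<^sup>2) * (k * (sq_var q + 4 * D) + x * sq_var s)))"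
    using e[unfolded sq, unfolded q] e' unfolding sq by (simp add: power2_eq_square algebra_simps)
  then have "4 dvd (q\<^sup>2 * x) * sq_var (s - t)"
    by (simp only: pcompose_diff dvd_triv_left)
  moreover have "lead_coeff q = 1"
    unfolding q_def by (rule monic_char_poly_block)
  then have "lead_coeff (q\<^sup>2 * x) = 1"
    by (simp only: lead_coeff_mult lead_coeff_power) (simp add: x_def)
  ultimately have "4 dvd sq_var (s - t)"
    using dvd_cancel_monic by blast
  then have "4 dvd coeff (sq_var (s - t)) (2 * i)" for i
    unfolding numeral_dvd_poly_iff by blast
  then show ?thesis
    unfolding numeral_dvd_poly_iff coeff_sq_var_even s_def t_def by blast
qed

text \<open>
  For \<open>M = y I - A\<close>, the substitution \<open>y = -1 - x\<close> turns \<open>M + J\<close> into \<open>-(x I - (J - I - A))\<close>.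
\<close>

lemma char_poly_complement:
  fixes a :: "nat \<Rightarrow> nat \<Rightarrow> int"
  assumes "\<And>i. a i i = 0"
  shows "char_poly (block n (\<lambda>i j. if i = j then 0 else 1 - a i j))
    = (- 1) ^ n * ((char_poly (block n a) + adj_sum (char_poly_matrix (block n a))) \<circ>\<^sub>p [:- 1, - 1:])"
proof -
  have subst: "comm_ring_hom (\<lambda>p :: int poly. p \<circ>\<^sub>p [:- 1, - 1:])"
    by unfold_locales (simp_all add: pcompose_add pcompose_mult pcompose_1)
  define M where "M = char_poly_matrix (block n a)"
  have M: "M \<in> carrier_mat n n" by (simp add: M_def)
  have "det M \<noteq> 0"
    using monic_char_poly_block[of n a] by (metis M_def char_poly_def leading_coeff_0_iff zero_neq_one)
  note ones = det_add_all_ones[OF M this]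
  have "char_poly_matrix (block n (\<lambda>i j. if i = j then 0 else 1 - a i j))
      = - 1 \<cdot>\<^sub>m map_mat (\<lambda>p. p \<circ>\<^sub>p [:- 1, - 1:]) (M + mat n n (\<lambda>_. 1))"
    using assms by (intro eq_matI)
      (auto simp: M_def char_poly_matrix_block pcompose_diff pcompose_add pcompose_pCons pcompose_1)
  then have "char_poly (block n (\<lambda>i j. if i = j then 0 else 1 - a i j))
      = (- 1) ^ n * (det (M + mat n n (\<lambda>_. 1)) \<circ>\<^sub>p [:- 1, - 1:])"
    using M by (simp add: char_poly_def comm_ring_hom.hom_det[OF subst])
  then show ?thesis
    unfolding ones by (simp add: M_def char_poly_def)
qed

lemma char_poly_complement_determined_mod4:
  fixes a b :: "nat \<Rightarrow> nat \<Rightarrow> int"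
  assumes "\<And>i j. a i j = a j i" "\<And>i. a i i = 0"
    and "\<And>i j. b i j = b j i" "\<And>i. b i i = 0"
    and cong: "4 dvd char_poly (block n a) - char_poly (block n b)"
  shows "4 dvd char_poly (block n (\<lambda>i j. if i = j then 0 else 1 - a i j))
    - char_poly (block n (\<lambda>i j. if i = j then 0 else 1 - b i j))"
proof -
  define P where "P c = char_poly (block n c) + adj_sum (char_poly_matrix (block n c))"
    for c :: "nat \<Rightarrow> nat \<Rightarrow> int"
  have "4 dvd adj_sum (char_poly_matrix (block n a)) - adj_sum (char_poly_matrix (block n b))"
    using assms by (intro adj_sum_determined_mod4) auto
  then have "4 dvd P a - P b"
    using dvd_add[OF cong] by (simp add: P_def add_diff_add)
  then obtain d where "P a - P b = 4 * d" unfolding dvd_def by blast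
  then have "(P a - P b) \<circ>\<^sub>p [:- 1, - 1:] = 4 * (d \<circ>\<^sub>p [:- 1, - 1:])"
    by (simp add: pcompose_smult numeral_poly)
  then have "4 dvd (- 1) ^ n * (P a \<circ>\<^sub>p [:- 1, - 1:] - P b \<circ>\<^sub>p [:- 1, - 1:])"
    by (simp add: pcompose_diff)
  then show ?thesis
    using assms by (simp add: char_poly_complement P_def right_diff_distrib)
qed

lemma char_poly_graph_block:
  assumes "pair_graph G"
  obtains a where "\<And>i j. a i j = a j i" "\<And>i. a i i = 0"
    "graph_char_poly G = char_poly (block (card (pverts G)) a)"
    "graph_char_poly (graph_complement G)
      = char_poly (block (card (pverts G)) (\<lambda>i j. if i = j then 0 else 1 - a i j))"
proof -
  interpret pair_graph G by fact
  define vs where "vs = vertex_enum G"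
  have vs: "distinct vs" "set vs = pverts G"
    unfolding vs_def by (rule vertex_enum[OF pair_finite_verts])+
  then have n: "length vs = card (pverts G)" by (metis distinct_card)
  define a :: "nat \<Rightarrow> nat \<Rightarrow> int"
    where "a i j = (if (vs ! i, vs ! j) \<in> parcs G then 1 else 0)" for i j
  have in_verts: "vs ! i \<in> pverts G" if "i < length vs" for i
    using that vs by (metis nth_mem)
  show thesis
  proof
    show "a i j = a j i" for i j
      unfolding a_def using arcs_symmetric by auto
    show "a i i = 0" for i
      unfolding a_def using pair_no_loops by fastforce
    show "graph_char_poly G = char_poly (block (card (pverts G)) a)"
      by (simp add: graph_char_poly_def vs_def[symmetric] adjacency_mat_def block_def a_def n)
    have "adjacency_mat (graph_complement G) vs
        = block (card (pverts G)) (\<lambda>i j. if i = j then 0 else 1 - a i j)"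
      using vs(1) in_verts
      by (intro eq_matI)
        (auto simp: adjacency_mat_def graph_complement_def a_def n nth_eq_iff_index_eq)
    moreover have "graph_char_poly (graph_complement G)
        = char_poly (adjacency_mat (graph_complement G) vs)"
      using vs by (intro graph_char_poly_eq) (simp_all add: graph_complement_def)
    ultimately show "graph_char_poly (graph_complement G)
        = char_poly (block (card (pverts G)) (\<lambda>i j. if i = j then 0 else 1 - a i j))"
      by simp
  qed
qed

theorem theorem12:
  fixes G :: "'a pair_pre_digraph" and H :: "'b pair_pre_digraph"
  assumes "pair_graph G" and "pair_graph H"
    and "\<forall>k. [coeff (graph_char_poly G) k = coeff (graph_char_poly H) k] (mod 4)"
  shows "\<forall>k. [coeff (graph_char_poly (graph_complement G)) k =
              coeff (graph_char_poly (graph_complement H)) k] (mod 4)"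
proof -
  have cong_iff: "(\<forall>k. [coeff p k = coeff q k] (mod 4)) \<longleftrightarrow> 4 dvd p - q" for p q :: "int poly"
    by (simp add: numeral_dvd_poly_iff cong_iff_dvd_diff)
  define n m where "n = card (pverts G)" and "m = card (pverts H)"
  obtain a where a: "\<And>i j. a i j = a j i" "\<And>i. a i i = 0"
    "graph_char_poly G = char_poly (block n a)"
    "graph_char_poly (graph_complement G)
      = char_poly (block n (\<lambda>i j. if i = j then 0 else 1 - a i j))"
    unfolding n_def using char_poly_graph_block[OF assms(1)] by blast
  obtain b where b: "\<And>i j. b i j = b j i" "\<And>i. b i i = 0"
    "graph_char_poly H = char_poly (block m b)"
    "graph_char_poly (graph_complement H)
      = char_poly (block m (\<lambda>i j. if i = j then 0 else 1 - b i j))"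
    unfolding m_def using char_poly_graph_block[OF assms(2)] by blast
  have cong: "4 dvd char_poly (block n a) - char_poly (block m b)"
    using assms(3) unfolding cong_iff a(3) b(3) .
  then have "n = m"
    using monic_cong_imp_degree_eq[OF monic_char_poly_block(2) monic_char_poly_block(2)]
    by (simp add: monic_char_poly_block(1))
  have "4 dvd char_poly (block n (\<lambda>i j. if i = j then 0 else 1 - a i j))
    - char_poly (block m (\<lambda>i j. if i = j then 0 else 1 - b i j))"
    using cong unfolding \<open>n = m\<close>
    by (intro char_poly_complement_determined_mod4 a(1,2) b(1,2))
  then show ?thesis
    unfolding cong_iff a(4) b(4) .
qed

end
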